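(* Let $c=\frac{3-\sqrt5}{2}$. Let $q_1,q_2,\dots$ be any infinite sequence of primes with $2^{2j-1}<q_j\le 2^{2j+1}$ for all $j\ge1$, and for each $j$ let $g_j$ be any primitive root modulo $q_j$. Let $A=(a_p)_{p\in\mathcal P}$ be the sequence $A_{\overline q,c}$ defined in the context. Then $A$ is an infinite Sidon sequence (all sums $a+a'$ with $a\le a'$, $a,a'\in A$, are distinct), and its counting function satisfies $A(x)=x^{\frac{3-\sqrt5}{2}+o(1)}$ as $x\to\infty$.
   Context: Construction of $A_{\overline q,c}$ (for a fixed $c$ with $0<c<1/2$): Let $\mathcal P$ be the set of all primes and partition it as $\mathcal P=\bigcup_{k\ge2}\mathcal P_k$ with $\mathcal P_k=\{p \text{ prime}: 2^{c(k-1)^2-3}<p\le 2^{ck^2-3}\}$. Use the mixed-radix base $\overline q=4q_1,4q_2,\dots$: every nonnegative integer $n$ is written uniquely as $n=\sum_{j\ge1}x_j\prod_{i<j}(4q_i)$ with digits $0\le x_j<4q_j$. For $p\in\mathcal P_k$ and $1\le j\le k$, let $x_j(p)$ be the integer with $q_j+1\le x_j(p)\le 2q_j-1$ and $g_j^{x_j(p)}\equiv p\pmod{q_j}$; set $x_j(p)=0$ for $j>k$. Define $a_p=\sum_{j=1}^{k}x_j(p)\prod_{i<j}(4q_i)$. The counting function is $A(x)=\#\{p\in\mathcal P: a_p\le x\}$.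
   Formalization: The sequence is indexed only by primes p in P_k with p ≠ q_j for all j ≤ k, since for p = q_j (e.g. p = q_1) the digit x_j(p) does not exist; this omits only finitely many primes. *)

theory Defs
  imports Complex_Main "HOL-Number_Theory.Number_Theory" "HOL-Library.Landau_Symbols"
begin

definition sidon_set :: "nat set \<Rightarrow> bool" where
  "sidon_set S \<longleftrightarrow> (\<forall>a\<in>S. \<forall>a'\<in>S. \<forall>b\<in>S. \<forall>b'\<in>S.
     a \<le> a' \<longrightarrow> b \<le> b' \<longrightarrow> a + a' = b + b' \<longrightarrow> a = b \<and> a' = b')"

definition prime_block :: "real \<Rightarrow> nat \<Rightarrow> nat set" where
  "prime_block c k = {p. prime p \<and> 2 powr (c * (real k - 1)\<^sup>2 - 3) < real p
                               \<and> real p \<le> 2 powr (c * (real k)\<^sup>2 - 3)}"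

definition block_index :: "real \<Rightarrow> nat \<Rightarrow> nat" where
  "block_index c p = (THE k. k \<ge> 2 \<and> p \<in> prime_block c k)"

lemma ex1_prime_block:
  fixes c :: real and p :: nat
  assumes c: "0 < c" "c < 1/2" and p: "prime p"
  shows "\<exists>!k. k \<ge> 2 \<and> p \<in> prime_block c k"
proof -
  define P where "P k \<longleftrightarrow> real p \<le> 2 powr (c * (real k)\<^sup>2 - 3)" for k :: nat
  have P_mono: "P l" if "P k" "k \<le> l" for k l
  proof -
    have "c * (real k)\<^sup>2 \<le> c * (real l)\<^sup>2"
      using that c by (intro mult_left_mono power_mono) auto
    hence "2 powr (c * (real k)\<^sup>2 - 3) \<le> 2 powr (c * (real l)\<^sup>2 - 3)" by simp
    with that show ?thesis unfolding P_def by linarith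
  qed
  have ge2: "real p \<ge> 2" using prime_ge_2_nat[OF p] by simp
  have not_P1: "\<not> P 1"
  proof
    assume "P 1"
    moreover have "2 powr (c * (real 1)\<^sup>2 - 3) \<le> 2 powr (0::real)"
      using c by (intro powr_mono) auto
    ultimately show False using ge2 unfolding P_def by simp
  qed
  obtain m :: nat where m: "real m \<ge> (log 2 (real p) + 3) / c" "m \<ge> 1"
  proof -
    obtain n :: nat where "real n \<ge> (log 2 (real p) + 3) / c" using real_arch_simple by blast
    thus ?thesis by (intro that[of "max n 1"]) auto
  qed
  have "P m"
  proof -
    have "log 2 (real p) + 3 \<le> c * real m" using m(1) c by (simp add: field_simps)
    also have "\<dots> \<le> c * (real m)\<^sup>2"
      using m(2) c by (intro mult_left_mono) (auto simp: power2_eq_square)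
    finally have "log 2 (real p) \<le> c * (real m)\<^sup>2 - 3" by simp
    thus ?thesis unfolding P_def using ge2 by (simp add: log_le_iff)
  qed
  define k where "k = (LEAST k. P k)"
  have Pk: "P k" unfolding k_def by (rule LeastI) fact
  have k2: "k \<ge> 2"
  proof (rule ccontr)
    assume "\<not> k \<ge> 2"
    with P_mono[OF Pk, of 1] not_P1 show False by simp
  qed
  have notP: "\<not> P (k - 1)" unfolding k_def by (rule not_less_Least) (use k2 k_def in simp)
  have block: "p \<in> prime_block c l \<longleftrightarrow> \<not> P (l - 1) \<and> P l" if "l \<ge> 2" for l
    using that p by (simp add: prime_block_def P_def not_le of_nat_diff)
  show ?thesis
  proof (rule ex1I[of _ k])
    show "k \<ge> 2 \<and> p \<in> prime_block c k" using k2 block notP Pk by blast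
  next
    fix l assume l: "l \<ge> 2 \<and> p \<in> prime_block c l"
    hence "\<not> P (l - 1)" "P l" using block by auto
    have "\<not> l \<le> k - 1" using P_mono[OF \<open>P l\<close>] notP by blast
    moreover have "\<not> k \<le> l - 1" using P_mono[OF Pk] \<open>\<not> P (l - 1)\<close> by blast
    ultimately show "l = k" by linarith
  qed
qed

definition is_digit :: "(nat \<Rightarrow> nat) \<Rightarrow> (nat \<Rightarrow> nat) \<Rightarrow> nat \<Rightarrow> nat \<Rightarrow> nat \<Rightarrow> bool" where
  "is_digit q g p j x \<longleftrightarrow> x \<in> {q j + 1..2 * q j - 1} \<and> [g j ^ x = p] (mod q j)"

definition digit :: "real \<Rightarrow> (nat \<Rightarrow> nat) \<Rightarrow> (nat \<Rightarrow> nat) \<Rightarrow> nat \<Rightarrow> nat \<Rightarrow> nat" where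
  "digit c q g p j =
     (if j \<in> {1..block_index c p} then THE x. is_digit q g p j x else 0)"

lemma is_digit_unique:
  assumes q: "prime (q j)" and g: "residue_primroot (q j) (g j)"
    and x: "is_digit q g p j x" and y: "is_digit q g p j y"
  shows "x = y"
proof -
  have "[g j ^ x = g j ^ y] (mod q j)"
    using x y unfolding is_digit_def by (metis cong_sym cong_trans)
  hence "[x = y] (mod (q j - 1))"
    using g q by (simp add: residue_primroot_def order_divides_expdiff totient_prime)
  moreover have "x \<in> {q j + 1..2 * q j - 1}" "y \<in> {q j + 1..2 * q j - 1}"
    using x y unfolding is_digit_def by auto
  moreover have "u = v" if "[u = v] (mod (q j - 1))" "u \<le> v"
      "u \<in> {q j + 1..2 * q j - 1}" "v \<in> {q j + 1..2 * q j - 1}" for u v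
  proof -
    have "(q j - 1) dvd (v - u)" using that by (metis cong_altdef_nat cong_sym)
    moreover have "v - u < q j - 1" using that by auto
    ultimately have "v - u = 0" by (meson dvd_imp_le not_le zero_less_iff_neq_zero)
    thus ?thesis using that by simp
  qed
  ultimately show ?thesis by (metis cong_sym linear)
qed

lemma ex_is_digit_iff:
  assumes q: "prime (q j)" "q j > 2" and g: "residue_primroot (q j) (g j)" and p: "prime p"
  shows "(\<exists>x. is_digit q g p j x) \<longleftrightarrow> p \<noteq> q j"
proof
  assume "\<exists>x. is_digit q g p j x"
  then obtain x where "[g j ^ x = p] (mod q j)" by (auto simp: is_digit_def)
  moreover have "coprime (g j ^ x) (q j)"
    using g by (simp add: residue_primroot_def coprime_commute)
  ultimately have "coprime p (q j)" using cong_imp_coprime by blast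
  thus "p \<noteq> q j" using q by auto
next
  assume "p \<noteq> q j"
  hence cop: "coprime p (q j)" using p q primes_coprime by blast
  hence "p mod q j \<in> totatives (q j)"
    using q by (auto simp: totatives_def coprime_commute intro!: Nat.gr0I)
  also have "totatives (q j) = (\<lambda>i. g j ^ i mod q j) ` {..<q j - 1}"
    using residue_primroot_is_generator[OF _ g] q by (simp add: bij_betw_def totient_prime)
  finally obtain i where i: "i < q j - 1" "g j ^ i mod q j = p mod q j" by force
  define x where "x = (if i \<ge> 2 then i + (q j - 1) else i + 2 * (q j - 1))"
  have "[x = i] (mod (q j - 1))" by (simp add: x_def cong_def)
  hence "[g j ^ x = g j ^ i] (mod q j)"
    using g q by (simp add: residue_primroot_def order_divides_expdiff totient_prime)
  hence "[g j ^ x = p] (mod q j)" using i by (simp add: cong_def)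
  moreover have "x \<in> {q j + 1..2 * q j - 1}" using i q(2) by (auto simp: x_def)
  ultimately show "\<exists>x. is_digit q g p j x" unfolding is_digit_def by blast
qed

definition seq_term :: "real \<Rightarrow> (nat \<Rightarrow> nat) \<Rightarrow> (nat \<Rightarrow> nat) \<Rightarrow> nat \<Rightarrow> nat" where
  "seq_term c q g p =
     (\<Sum>j = 1..block_index c p. digit c q g p j * (\<Prod>i\<in>{1..<j}. 4 * q i))"

text \<open>
  If \<open>p = q j\<close> for some \<open>j\<close> not exceeding the block index of \<open>p\<close>, then no power of \<open>g j\<close> is
  congruent to \<open>p\<close> modulo \<open>q j\<close>, so the \<open>j\<close>-th digit of \<open>p\<close> does not exist. The sequence is
  therefore indexed by the primes all of whose digits exist. By the lemma
  \<open>index_primes_cofinite\<close> below, this leaves out only finitely many primes.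
\<close>

definition index_primes :: "real \<Rightarrow> (nat \<Rightarrow> nat) \<Rightarrow> (nat \<Rightarrow> nat) \<Rightarrow> nat set" where
  "index_primes c q g =
     {p. prime p \<and> (\<forall>j\<in>{1..block_index c p}. \<exists>x. is_digit q g p j x)}"

definition counting_fun :: "real \<Rightarrow> (nat \<Rightarrow> nat) \<Rightarrow> (nat \<Rightarrow> nat) \<Rightarrow> real \<Rightarrow> nat" where
  "counting_fun c q g x = card {p \<in> index_primes c q g. real (seq_term c q g p) \<le> x}"

lemma index_primes_cofinite:
  fixes c :: real and q g :: "nat \<Rightarrow> nat"
  assumes c: "0 < c" "c < 1/2"
    and q: "\<And>j. j \<ge> 1 \<Longrightarrow> prime (q j) \<and> 2 ^ (2 * j - 1) < q j \<and> q j \<le> 2 ^ (2 * j + 1)"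
    and g: "\<And>j. j \<ge> 1 \<Longrightarrow> residue_primroot (q j) (g j)"
  shows "index_primes c q g = {p. prime p \<and> (\<forall>j\<in>{1..block_index c p}. p \<noteq> q j)}"
    and "finite ({p. prime p} - index_primes c q g)"
proof -
  have gt2: "q j > 2" if "j \<ge> 1" for j
  proof -
    have "(2::nat) ^ 1 \<le> 2 ^ (2 * j - 1)" using that by (intro power_increasing) auto
    thus ?thesis using q[OF that] by simp
  qed
  show eq: "index_primes c q g = {p. prime p \<and> (\<forall>j\<in>{1..block_index c p}. p \<noteq> q j)}"
  proof -
    have "(\<exists>x. is_digit q g p j x) \<longleftrightarrow> p \<noteq> q j" if "prime p" "j \<ge> 1" for p j
      using ex_is_digit_iff[of q j g p] q g gt2 that by blast
    thus ?thesis unfolding index_primes_def by (intro Collect_cong conj_cong ball_cong) auto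
  qed
  obtain N :: nat where N: "real N \<ge> 6 / c" using real_arch_simple by blast
  have "{p. prime p} - index_primes c q g \<subseteq> q ` {1..N + 2}"
  proof
    fix p assume "p \<in> {p. prime p} - index_primes c q g"
    then obtain j where p: "prime p" and j: "1 \<le> j" "j \<le> block_index c p" "p = q j"
      unfolding eq by auto
    define k where "k = block_index c p"
    have k: "k \<ge> 2" "p \<in> prime_block c k"
      using theI'[OF ex1_prime_block[OF c p]] unfolding k_def block_index_def by auto
    have "2 powr (c * (real k - 1)\<^sup>2 - 3) < real p" using k by (simp add: prime_block_def)
    also have "real p \<le> real (2 ^ (2 * j + 1))" using q[OF j(1)] j(3) of_nat_le_iff by blast
    also have "\<dots> = 2 powr (real (2 * j + 1))" by (subst powr_realpow) auto
    also have "\<dots> \<le> 2 powr (real (2 * k + 1))" using j k_def by (intro powr_mono) auto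
    finally have *: "c * (real k - 1)\<^sup>2 < 2 * real k + 4" by simp
    have "k \<le> N + 2"
    proof (rule ccontr)
      assume "\<not> k \<le> N + 2"
      hence kN: "real k \<ge> real N + 3" by linarith
      hence "6 / c \<le> real k - 1" using N by linarith
      hence "6 \<le> c * (real k - 1)" using c by (simp add: field_simps)
      hence "6 * (real k - 1) \<le> c * (real k - 1) * (real k - 1)"
        using kN by (intro mult_right_mono) auto
      with * kN show False by (simp add: power2_eq_square mult.assoc)
    qed
    thus "p \<in> q ` {1..N + 2}" using j k_def by auto
  qed
  thus "finite ({p. prime p} - index_primes c q g)" by (rule finite_subset) auto
qed

end

theory Submission
  imports Defs "HOL-Real_Asymp.Real_Asymp"
begin

text \<open>
  Digits of sums do not carry, so \<open>a\<^sub>p + a\<^sub>r = a\<^sub>p' + a\<^sub>r'\<close> forces equal digit sums, hence equal block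
  indices \<open>k \<ge> l\<close> on both sides, \<open>p \<equiv> p'\<close> modulo \<open>q\<^sub>j\<close> for \<open>l < j \<le> k\<close>, and \<open>p r \<equiv> p' r'\<close> modulo
  \<open>q\<^sub>j\<close> for \<open>j \<le> l\<close>. As \<open>q\<^sub>m\<^sub>+\<^sub>1 \<cdots> q\<^sub>n > 2^(n\<^sup>2 - m\<^sup>2)\<close>, distinct pairs would give
  \<open>(1 - c) k\<^sup>2 < l\<^sup>2\<close> and \<open>(1 - c) l\<^sup>2 < c k\<^sup>2\<close>, which is contradictory once \<open>c \<le> (1 - c)\<^sup>2\<close>; the
  value \<open>c = (3 - sqrt 5) / 2\<close> is the case of equality.

  For the counting function, a prime in block \<open>k\<close> has \<open>2^(k\<^sup>2) \<le> a\<^sub>p < 2^(k\<^sup>2 + 4 k)\<close> and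
  \<open>p \<le> 2^(c k\<^sup>2 - 3)\<close>. This gives \<open>A(x) \<le> x^c\<close>, and the lower bound follows from a
  Chebyshev-type estimate for the number of primes.
\<close>

section \<open>A Chebyshev-type lower bound for the number of primes\<close>

text \<open>
  The numbers \<open>1 / (m * (n choose m))\<close> form Leibniz' harmonic triangle: each is the difference of
  two entries in the preceding column. So multiplying by \<open>L\<close> makes all of them integers as soon as
  it does so for the first column.
\<close>

lemma mult_binomial_dvd:
  fixes L m n :: nat
  assumes "\<And>i. 1 \<le> i \<Longrightarrow> i \<le> n \<Longrightarrow> i dvd L" and "1 \<le> m" "m \<le> n"
  shows "m * (n choose m) dvd L"
  using assms(2,3,1)
proof (induction m arbitrary: n rule: nat_induct_at_least)
  case base
  thus ?case by simp
next
  case (Suc m)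
  define X where "X = Suc m * (n choose Suc m)"
  have "m * (n choose m) dvd L" "m * ((n - 1) choose m) dvd L"
    using Suc by auto
  then obtain a b where a: "L = m * ((n - 1) choose m) * a" and b: "L = m * (n choose m) * b"
    by (elim dvdE)
  have X: "X = n * ((n - 1) choose m)" "X = (n - m) * (n choose m)"
    using binomial_absorption[of m n] binomial_absorb_comp[of n m] by (auto simp: X_def)
  \<comment> \<open>In terms of quotients, \<open>a\<close> is n L / (m X) and \<open>b\<close> is
    (n - m) L / (m X), so \<open>a - b\<close> is L / X. Working in the integers keeps this
    difference free of truncation.\<close>
  have "int m * int X * int a = int n * int L"
    by (subst a, subst X(1)) simp
  moreover have "int m * int X * int b = (int n - int m) * int L"
    using Suc.prems(1) by (subst b, subst X(2)) (simp add: of_nat_diff)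
  ultimately have "int m * (int X * (int a - int b)) = int m * int L"
    by (simp add: algebra_simps)
  hence "int X * (int a - int b) = int L" using Suc.hyps by simp
  hence "int X dvd int L" by (metis dvd_triv_left)
  thus ?case unfolding X_def by (simp only: int_dvd_int_iff)
qed

text \<open>Nair's argument: \<open>L\<close> is the least common multiple of 1, ..., n. Each term i
  * (n choose i) with i at least 1 divides it, and these terms add up to n * 2^(n-1), so
  \<open>L\<close> is at least 2^(n-1). On the other hand every prime power in \<open>L\<close> is
  at most n.\<close>

lemma card_primes_lower_bound:
  fixes n :: nat
  assumes "n \<ge> 1"
  shows "2 ^ (n - 1) \<le> n ^ card {p. prime p \<and> p \<le> n}"
proof -
  let ?P = "{p. prime p \<and> p \<le> n}"
  define e where "e p = Max {i. p ^ i \<le> n}" for p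
  define L where "L = (\<Prod>p\<in>?P. p ^ e p)"
  have fin: "finite {i. p ^ i \<le> n}" if "prime p" for p
  proof (rule finite_subset)
    show "{i. p ^ i \<le> n} \<subseteq> {..n}"
    proof
      fix i assume "i \<in> {i. p ^ i \<le> n}"
      moreover have "i < p ^ i" using prime_gt_1_nat[OF that] by (simp add: power_gt_expt)
      ultimately show "i \<in> {..n}" by simp
    qed
  qed simp
  have e: "p ^ e p \<le> n" if "prime p" for p
  proof -
    have "{i. p ^ i \<le> n} \<noteq> {}" using assms by (auto intro!: exI[of _ 0])
    from Max_in[OF fin[OF that] this] show ?thesis by (simp add: e_def)
  qed
  have "L > 0" unfolding L_def by (intro prod_pos) (auto dest: prime_gt_0_nat)
  have dvd: "m dvd L" if m: "1 \<le> m" "m \<le> n" for m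
  proof -
    have "m = (\<Prod>p\<in>prime_factors m. p ^ multiplicity p m)"
      using m by (intro prime_factorization_nat) simp
    also have "\<dots> dvd (\<Prod>p\<in>prime_factors m. p ^ e p)"
    proof (intro prod_dvd_prod le_imp_power_dvd)
      fix p assume p: "p \<in> prime_factors m"
      have "p ^ multiplicity p m \<le> m"
        using m by (intro dvd_imp_le multiplicity_dvd) simp
      thus "multiplicity p m \<le> e p" unfolding e_def using m p
        by (intro Max_ge fin) auto
    qed
    also have "\<dots> dvd L" unfolding L_def
    proof (rule prod_dvd_prod_subset)
      show "prime_factors m \<subseteq> ?P"
        using m by (auto simp: in_prime_factors_iff dest!: dvd_imp_le)
    qed simp
    finally show ?thesis .
  qed
  have "n * 2 ^ (n - 1) = (\<Sum>i\<le>n. i * (n choose i))"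
    by (rule choose_linear_sum [symmetric])
  also have "\<dots> = (\<Sum>i=1..n. i * (n choose i))"
    by (rule sum.mono_neutral_right) (auto simp: not_le)
  also have "\<dots> \<le> (\<Sum>i=1..n. L)"
    using mult_binomial_dvd[OF dvd] \<open>L > 0\<close> by (intro sum_mono dvd_imp_le) auto
  also have "\<dots> = n * L" by simp
  finally have "2 ^ (n - 1) \<le> L" using assms by simp
  also have "L \<le> (\<Prod>p\<in>?P. n)" unfolding L_def using e by (intro prod_mono) auto
  also have "\<dots> = n ^ card ?P" by simp
  finally show ?thesis .
qed

section \<open>Mixed-radix expansions and the size of congruent numbers\<close>

lemma mixed_radix_less:
  fixes b x :: "nat \<Rightarrow> nat"
  assumes "\<And>j. 1 \<le> j \<Longrightarrow> j \<le> n \<Longrightarrow> x j < b j"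
  shows "(\<Sum>j = 1..n. x j * (\<Prod>i\<in>{1..<j}. b i)) < (\<Prod>i\<in>{1..n}. b i)"
  using assms
proof (induction n)
  case (Suc n)
  have "(\<Sum>j = 1..Suc n. x j * (\<Prod>i\<in>{1..<j}. b i))
      < (\<Prod>i\<in>{1..n}. b i) + x (Suc n) * (\<Prod>i\<in>{1..n}. b i)"
    using Suc by (simp add: atLeastLessThanSuc_atLeastAtMost)
  also have "\<dots> = Suc (x (Suc n)) * (\<Prod>i\<in>{1..n}. b i)" by simp
  also have "\<dots> \<le> b (Suc n) * (\<Prod>i\<in>{1..n}. b i)"
    using Suc.prems[of "Suc n"] by (intro mult_right_mono) auto
  finally show ?case by (simp add: mult.commute)
qed simp

lemma mixed_radix_unique:
  fixes b x y :: "nat \<Rightarrow> nat"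
  assumes "\<And>j. 1 \<le> j \<Longrightarrow> j \<le> n \<Longrightarrow> x j < b j" "\<And>j. 1 \<le> j \<Longrightarrow> j \<le> n \<Longrightarrow> y j < b j"
    and "(\<Sum>j = 1..n. x j * (\<Prod>i\<in>{1..<j}. b i)) = (\<Sum>j = 1..n. y j * (\<Prod>i\<in>{1..<j}. b i))"
    and "1 \<le> j" "j \<le> n"
  shows "x j = y j"
  using assms
proof (induction n)
  case (Suc n)
  let ?B = "\<Prod>i\<in>{1..n}. b i"
  let ?S = "\<lambda>x. \<Sum>j = 1..n. x j * (\<Prod>i\<in>{1..<j}. b i)"
  have less: "?S x < ?B" "?S y < ?B" using Suc.prems by (intro mixed_radix_less; simp)+
  have eq: "?S x + x (Suc n) * ?B = ?S y + y (Suc n) * ?B"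
    using Suc.prems(3) by (simp add: atLeastLessThanSuc_atLeastAtMost)
  \<comment> \<open>Both lower parts lie below the place value of the top digit, so division by it
    isolates that digit.\<close>
  have quot: "(s + t * B) div B = t" if "s < B" for s t B :: nat
    using that by simp
  have top: "x (Suc n) = y (Suc n)"
    using quot[OF less(1), of "x (Suc n)"] quot[OF less(2), of "y (Suc n)"] eq by simp
  hence "?S x = ?S y" using eq by simp
  with Suc top show ?case by (cases "j = Suc n") auto
qed simp

lemma cong_neq_imp_le:
  fixes x y m B :: nat
  assumes "[x = y] (mod m)" "x \<noteq> y" "x \<le> B" "y \<le> B"
  shows "m \<le> B"
proof -
  have "m \<le> v - u" if "[u = v] (mod m)" "u < v" for u v
    using that by (metis cong_altdef_nat cong_sym dvd_imp_le less_imp_le zero_less_diff)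
  from this[of x y] this[of y x] assms show ?thesis
    by (metis cong_sym diff_le_self le_trans linorder_neqE_nat)
qed


section \<open>The setting for general c in (0, 1/2), and the digits of a_p\<close>

locale digit_base =
  fixes c :: real and q g :: "nat \<Rightarrow> nat"
  assumes c: "0 < c" "c < 1 / 2"
    and q_prime: "j \<ge> 1 \<Longrightarrow> prime (q j)"
    and q_lower: "j \<ge> 1 \<Longrightarrow> 2 ^ (2 * j - 1) < q j"
    and q_upper: "j \<ge> 1 \<Longrightarrow> q j \<le> 2 ^ (2 * j + 1)"
    and primroot: "j \<ge> 1 \<Longrightarrow> residue_primroot (q j) (g j)"
begin

abbreviation "blk \<equiv> block_index c"
abbreviation "D \<equiv> digit c q g"
abbreviation "a \<equiv> seq_term c q g"
abbreviation "I \<equiv> index_primes c q g"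

lemma index_primes_primeD: "p \<in> I \<Longrightarrow> prime p"
  by (simp add: index_primes_def)

lemma
  assumes "prime p"
  shows blk_ge_2: "blk p \<ge> 2"
    and blk_lower: "2 powr (c * (real (blk p) - 1)\<^sup>2 - 3) < real p"
    and blk_upper: "real p \<le> 2 powr (c * (real (blk p))\<^sup>2 - 3)"
  using theI'[OF ex1_prime_block[OF c assms]] unfolding block_index_def[symmetric]
  by (auto simp: prime_block_def)

lemma blk_ge_1: "p \<in> I \<Longrightarrow> 1 \<le> blk p"
  using blk_ge_2[OF index_primes_primeD, of p] by simp

lemma is_digit_digit:
  assumes "p \<in> I" "1 \<le> j" "j \<le> blk p"
  shows "is_digit q g p j (D p j)"
proof -
  have "\<exists>!x. is_digit q g p j x"
  proof (rule ex_ex1I)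
    show "\<exists>x. is_digit q g p j x" using assms by (simp add: index_primes_def)
  next
    fix x y assume "is_digit q g p j x" "is_digit q g p j y"
    thus "x = y" using q_prime[OF assms(2)] primroot[OF assms(2)] is_digit_unique by blast
  qed
  from theI'[OF this] show ?thesis using assms by (simp add: digit_def)
qed

lemma digit_bounds:
  assumes "p \<in> I" "1 \<le> j" "j \<le> blk p"
  shows "q j < D p j" "D p j < 2 * q j"
  using is_digit_digit[OF assms] by (auto simp: is_digit_def)

lemma digit_cong:
  assumes "p \<in> I" "1 \<le> j" "j \<le> blk p"
  shows "[g j ^ D p j = p] (mod q j)"
  using is_digit_digit[OF assms] by (auto simp: is_digit_def)

lemma digit_beyond: "blk p < j \<Longrightarrow> D p j = 0"
  by (simp add: digit_def)

text \<open>Digits inside the block exceed q_j, so zeros mark exactly the positions beyond it: the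
  digits determine the block index.\<close>

lemma digit_eq_0_iff: "p \<in> I \<Longrightarrow> j \<ge> 1 \<Longrightarrow> D p j = 0 \<longleftrightarrow> blk p < j"
  using digit_bounds(1)[of p j] digit_beyond[of p j] by (cases "blk p < j") auto

lemma q_pos: "j \<ge> 1 \<Longrightarrow> q j > 0"
  using q_prime prime_gt_0_nat by blast

lemma digit_less: "p \<in> I \<Longrightarrow> j \<ge> 1 \<Longrightarrow> D p j < 2 * q j"
  using digit_bounds(2)[of p j] digit_beyond[of p j] q_pos[of j] by (cases "blk p < j") auto

lemma seq_term_eq:
  assumes "blk p \<le> K"
  shows "a p = (\<Sum>j = 1..K. D p j * (\<Prod>i\<in>{1..<j}. 4 * q i))"
  unfolding seq_term_def using assms by (intro sum.mono_neutral_left) (auto simp: digit_beyond)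

text \<open>Every digit is below 2 q_j, so the sum of two stays below the base 4 q_j and nothing is
  carried. All four expansions are padded with zero digits to a common length
  \<open>K\<close>.\<close>

lemma digit_sum_eq:
  assumes "p \<in> I" "r \<in> I" "p' \<in> I" "r' \<in> I" and eq: "a p + a r = a p' + a r'" and "j \<ge> 1"
  shows "D p j + D r j = D p' j + D r' j"
proof -
  define K where "K = Max {blk p, blk r, blk p', blk r', j}"
  have K: "blk p \<le> K" "blk r \<le> K" "blk p' \<le> K" "blk r' \<le> K" "j \<le> K"
    by (auto simp: K_def)
  have less: "D u i + D v i < 4 * q i" if "u \<in> I" "v \<in> I" "1 \<le> i" for u v i
    using digit_less[of u i] digit_less[of v i] that by linarith
  show ?thesis
  proof (rule mixed_radix_unique[where b = "\<lambda>i. 4 * q i" and n = K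
        and x = "\<lambda>j. D p j + D r j" and y = "\<lambda>j. D p' j + D r' j"])
    show "(\<Sum>j = 1..K. (D p j + D r j) * (\<Prod>i\<in>{1..<j}. 4 * q i)) =
          (\<Sum>j = 1..K. (D p' j + D r' j) * (\<Prod>i\<in>{1..<j}. 4 * q i))"
      using eq K by (simp add: seq_term_eq[of _ K] add_mult_distrib sum.distrib)
  qed (use assms K less in auto)
qed

section \<open>Products of the q_j and simultaneous congruences\<close>

lemma q_coprime:
  assumes "1 \<le> i" "1 \<le> j" "i \<noteq> j"
  shows "coprime (q i) (q j)"
proof -
  \<comment> \<open>The dyadic ranges prescribed for different indices are disjoint and
    ordered.\<close>
  have "q i < q j" if "1 \<le> i" "i < j" for i j
  proof -
    have "q i \<le> 2 ^ (2 * i + 1)" using q_upper that by simp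
    also have "\<dots> \<le> 2 ^ (2 * j - 1)" using that by (intro power_increasing) auto
    also have "\<dots> < q j" using q_lower that by simp
    finally show ?thesis .
  qed
  hence "q i \<noteq> q j" using assms by (metis less_irrefl linorder_neqE_nat)
  thus ?thesis using assms by (intro primes_coprime q_prime)
qed

text \<open>The exponents 2 j - 1 of the lower bounds on q_j add up to n^2 - m^2.\<close>

lemma prod_q_lower:
  assumes "m \<le> n"
  shows "2 ^ (n\<^sup>2) \<le> 2 ^ (m\<^sup>2) * (\<Prod>j\<in>{m<..n}. q j)"
  using assms
proof (induction n rule: dec_induct)
  case (step n)
  have "2 ^ ((Suc n)\<^sup>2) = 2 ^ (n\<^sup>2) * (2 ^ (2 * Suc n - 1) :: nat)"
    by (simp add: power_add [symmetric] power2_eq_square)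
  also have "\<dots> \<le> (2 ^ (m\<^sup>2) * (\<Prod>j\<in>{m<..n}. q j)) * q (Suc n)"
    using step.IH q_lower[of "Suc n"] by (intro mult_mono) auto
  also have "{m<..Suc n} = insert (Suc n) {m<..n}" using step by auto
  hence "(2 ^ (m\<^sup>2) * (\<Prod>j\<in>{m<..n}. q j)) * q (Suc n) = 2 ^ (m\<^sup>2) * (\<Prod>j\<in>{m<..Suc n}. q j)"
    by simp
  finally show ?case .
qed simp

text \<open>This is the source of all size contradictions below. By coprimality the congruences
  combine to one modulo the product of the q_j, and distinct congruent numbers cannot both be
  smaller than their modulus, which is at least 2^(n^2 - m^2).\<close>

lemma cong_imp_square_diff_le:
  fixes x y m n :: nat and B :: real
  assumes "m \<le> n" "\<And>j. m < j \<Longrightarrow> j \<le> n \<Longrightarrow> [x = y] (mod q j)" "x \<noteq> y"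
    and "real x \<le> 2 powr B" "real y \<le> 2 powr B"
  shows "(real n)\<^sup>2 - (real m)\<^sup>2 \<le> B"
proof -
  let ?Q = "\<Prod>j\<in>{m<..n}. q j"
  have "[x = y] (mod ?Q)" using assms by (intro coprime_cong_prod_nat q_coprime) auto
  hence "?Q \<le> max x y" by (rule cong_neq_imp_le) (use assms in auto)
  hence "real ?Q \<le> real (max x y)" by linarith
  also have "\<dots> \<le> 2 powr B" using assms by (simp add: max_def)
  finally have Q: "real ?Q \<le> 2 powr B" .
  have "2 powr ((real n)\<^sup>2) = real (2 ^ (n\<^sup>2))"
    using powr_realpow[of 2 "n\<^sup>2"] by simp
  also have "\<dots> \<le> real (2 ^ (m\<^sup>2) * ?Q)" using prod_q_lower[OF assms(1)] by (rule of_nat_mono)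
  also have "\<dots> = 2 powr ((real m)\<^sup>2) * real ?Q"
    using powr_realpow[of 2 "m\<^sup>2"] by simp
  also have "\<dots> \<le> 2 powr ((real m)\<^sup>2) * 2 powr B" using Q by (intro mult_left_mono) auto
  also have "\<dots> = 2 powr ((real m)\<^sup>2 + B)" by (simp add: powr_add)
  finally show ?thesis by simp
qed

section \<open>The Sidon property\<close>

lemma digits_eq_imp_eq:
  assumes "p \<in> I" "r \<in> I" and eq: "\<And>j. j \<ge> 1 \<Longrightarrow> D p j = D r j"
  shows "p = r"
proof (rule ccontr)
  assume "p \<noteq> r"
  \<comment> \<open>Otherwise the digit at the larger block index would be zero for one prime and
    nonzero for the other.\<close>
  have "\<not> blk r < blk p" "\<not> blk p < blk r"
    using assms(1,2) eq[of "blk p"] eq[of "blk r"] blk_ge_1[of p] blk_ge_1[of r]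
    by (metis digit_eq_0_iff less_irrefl)+
  hence "blk p = blk r" by simp
  note upper = assms(1,2)[THEN index_primes_primeD, THEN blk_upper]
  \<comment> \<open>With k the common block index, distinct primes would give k^2 \<le> c k^2 - 3,
    impossible for c < 1.\<close>
  have "(real (blk p))\<^sup>2 - (real 0)\<^sup>2 \<le> c * (real (blk p))\<^sup>2 - 3"
  proof (rule cong_imp_square_diff_le)
    fix j assume j: "0 < j" "j \<le> blk p"
    show "[p = r] (mod q j)"
      using digit_cong[of p j] digit_cong[of r j] eq[of j] j \<open>blk p = blk r\<close> assms
      by (auto intro: cong_trans cong_sym)
  qed (use \<open>p \<noteq> r\<close> \<open>blk p = blk r\<close> upper in auto)
  moreover have "c * (real (blk p))\<^sup>2 \<le> 1 * (real (blk p))\<^sup>2"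
    using c by (intro mult_right_mono) auto
  ultimately show False by simp
qed

text \<open>The range of the digits between q_j and 2 q_j shows in their sum how many summands reach
  position j: none gives 0, one gives less than 2 q_j, two give more than 2 q_j. Exchanging the two
  sides turns the inequalities into equalities.\<close>

lemma blk_eq:
  assumes I: "p \<in> I" "r \<in> I" "p' \<in> I" "r' \<in> I" and eq: "a p + a r = a p' + a r'"
    and le: "blk r \<le> blk p" "blk r' \<le> blk p'"
  shows "blk p \<le> blk p'" "blk r \<le> blk r'"
proof -
  have ge: "blk p \<ge> 1" "blk r \<ge> 1"
    using blk_ge_1 I by simp_all
  note sum_eq = digit_sum_eq[OF I eq]
  show p: "blk p \<le> blk p'"
  proof (rule ccontr)
    assume "\<not> blk p \<le> blk p'"
    hence "D p' (blk p) = 0" "D r' (blk p) = 0" using le by (auto intro: digit_beyond)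
    thus False using sum_eq[OF ge(1)] digit_bounds(1)[OF I(1) ge(1)] by simp
  qed
  show "blk r \<le> blk r'"
  proof (rule ccontr)
    assume "\<not> blk r \<le> blk r'"
    hence "D r' (blk r) = 0" by (auto intro: digit_beyond)
    thus False
      using sum_eq[OF ge(2)] digit_bounds(1)[OF I(1) ge(2)] digit_bounds(1)[OF I(2) ge(2)]
        digit_less[OF I(3) ge(2)] le by simp
  qed
qed

lemma sum_eq_imp_eq_ordered:
  assumes golden: "c \<le> (1 - c)\<^sup>2"
    and I: "p \<in> I" "r \<in> I" "p' \<in> I" "r' \<in> I" and eq: "a p + a r = a p' + a r'"
    and le: "blk r \<le> blk p" "blk r' \<le> blk p'"
  shows "p = p' \<and> r = r' \<or> p = r' \<and> r = p'"
proof -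
  define k l where "k = blk p" and "l = blk r"
  have k: "blk p' = k" and l: "blk r' = l" and lk: "l \<le> k"
    using blk_eq[OF I eq le] blk_eq[OF I(3,4,1,2) eq[symmetric] le(2,1)] le
    by (simp_all add: k_def l_def)
  note sum_eq = digit_sum_eq[OF I eq]
  note prime = I[THEN index_primes_primeD]
  note upper = prime[THEN blk_upper, folded k_def l_def, unfolded k l]
  show ?thesis
  proof (cases "p = p'")
    case True
    have "D r j = D r' j" if "j \<ge> 1" for j using sum_eq[OF that] True by simp
    hence "r = r'" by (rule digits_eq_imp_eq[OF I(2,4)])
    with True show ?thesis by simp
  next
    case False
    show ?thesis
    proof (cases "p * r = p' * r'")
      case True
      \<comment> \<open>Unique factorization: equal products of two primes have the same
        factors.\<close>
      hence "p = p' \<or> p = r'"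
        using prime primes_dvd_imp_eq prime_dvd_mult_iff[of p p' r'] by (metis dvd_triv_left)
      thus ?thesis using False True prime prime_gt_0_nat[of p] by auto
    next
      case neq: False
      have "(real k)\<^sup>2 - (real l)\<^sup>2 \<le> c * (real k)\<^sup>2 - 3"
      proof (rule cong_imp_square_diff_le[OF lk])
        fix j assume j: "l < j" "j \<le> k"
        \<comment> \<open>Beyond position l only the primes of the larger block contribute to the
          digit sums.\<close>
        have "D p j = D p' j" using sum_eq[of j] digit_beyond[of r j] digit_beyond[of r' j] j l
          by (simp add: l_def)
        thus "[p = p'] (mod q j)"
          using digit_cong[OF I(1), of j] digit_cong[OF I(3), of j] j k
          by (auto simp: k_def intro: cong_trans cong_sym)
      qed (use False upper in auto)
      moreover have "(real l)\<^sup>2 - (real 0)\<^sup>2 \<le> (c * (real k)\<^sup>2 - 3) + (c * (real l)\<^sup>2 - 3)"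
      proof (rule cong_imp_square_diff_le)
        fix j assume j: "0 < j" "j \<le> l"
        \<comment> \<open>Digits are discrete logarithms, so equal digit sums mean congruent
          products.\<close>
        have "[g j ^ D p j * g j ^ D r j = p * r] (mod q j)"
          using j lk I by (intro cong_mult digit_cong) (auto simp: k_def l_def)
        moreover have "[g j ^ D p' j * g j ^ D r' j = p' * r'] (mod q j)"
          using j lk k l I by (intro cong_mult digit_cong) auto
        moreover have "g j ^ D p j * g j ^ D r j = g j ^ D p' j * g j ^ D r' j"
          using sum_eq[of j] j by (simp flip: power_add)
        ultimately show "[p * r = p' * r'] (mod q j)" by (metis cong_sym cong_trans)
      next
        show "real (p * r) \<le> 2 powr ((c * (real k)\<^sup>2 - 3) + (c * (real l)\<^sup>2 - 3))"
          "real (p' * r') \<le> 2 powr ((c * (real k)\<^sup>2 - 3) + (c * (real l)\<^sup>2 - 3))"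
          unfolding powr_add of_nat_mult using upper by (intro mult_mono; simp)+
      qed (use neq in auto)
      ultimately have "(1 - c) * (real k)\<^sup>2 + 3 \<le> (real l)\<^sup>2"
        and 2: "(1 - c) * (real l)\<^sup>2 + 6 \<le> c * (real k)\<^sup>2"
        by (simp_all add: algebra_simps)
      \<comment> \<open>Chaining this with the second inequality gives (1 - c)^2 k^2 + 3 (1 - c) + 6
        \<le> c k^2, against \<open>golden\<close>.\<close>
      hence "(1 - c) * ((1 - c) * (real k)\<^sup>2 + 3) \<le> (1 - c) * (real l)\<^sup>2"
        using c by (intro mult_left_mono) auto
      moreover have "c * (real k)\<^sup>2 \<le> (1 - c)\<^sup>2 * (real k)\<^sup>2"
        using golden by (intro mult_right_mono) auto
      ultimately show ?thesis using 2 c by (simp add: power2_eq_square algebra_simps)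
    qed
  qed
qed

lemma sum_eq_imp_eq:
  assumes "c \<le> (1 - c)\<^sup>2" "p \<in> I" "r \<in> I" "p' \<in> I" "r' \<in> I" "a p + a r = a p' + a r'"
  shows "p = p' \<and> r = r' \<or> p = r' \<and> r = p'"
proof -
  note * = sum_eq_imp_eq_ordered[OF assms(1)]
  have eqs: "a p + a r = a r' + a p'" "a r + a p = a p' + a r'" "a r + a p = a r' + a p'"
    using assms(6) by simp_all
  consider "blk r \<le> blk p" "blk r' \<le> blk p'" | "blk r \<le> blk p" "blk p' \<le> blk r'"
    | "blk p \<le> blk r" "blk r' \<le> blk p'" | "blk p \<le> blk r" "blk p' \<le> blk r'"
    by linarith
  thus ?thesis
  proof cases
    case 1
    from *[OF assms(2,3,4,5,6) 1] show ?thesis by blast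
  next
    case 2
    from *[OF assms(2,3,5,4) eqs(1) 2] show ?thesis by blast
  next
    case 3
    from *[OF assms(3,2,4,5) eqs(2) 3] show ?thesis by blast
  next
    case 4
    from *[OF assms(3,2,5,4) eqs(3) 4] show ?thesis by blast
  qed
qed

lemma inj_on_seq_term: "c \<le> (1 - c)\<^sup>2 \<Longrightarrow> inj_on a I"
  by (rule inj_onI) (metis sum_eq_imp_eq)

lemma sidon_set_seq_term:
  assumes "c \<le> (1 - c)\<^sup>2"
  shows "sidon_set (a ` I)"
  unfolding sidon_set_def
proof (intro ballI impI)
  fix s s' t t'
  assume "s \<in> a ` I" "s' \<in> a ` I" "t \<in> a ` I" "t' \<in> a ` I"
    and le: "s \<le> s'" "t \<le> t'" and eq: "s + s' = t + t'"
  then obtain p p' r r' where "p \<in> I" "p' \<in> I" "r \<in> I" "r' \<in> I"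
    and st: "s = a p" "s' = a p'" "t = a r" "t' = a r'"
    by blast
  with eq have "p = r \<and> p' = r' \<or> p = r' \<and> p' = r"
    by (intro sum_eq_imp_eq assms) simp_all
  thus "s = t \<and> s' = t'" using le st by auto
qed

section \<open>The growth of the counting function\<close>

lemma finite_non_index_primes: "finite ({p. prime p} - I)"
  using index_primes_cofinite(2)[OF c] q_prime q_lower q_upper primroot by blast

lemma infinite_index_primes: "infinite I"
  using finite_non_index_primes primes_infinite by (metis Diff_infinite_finite finite_Diff2)

text \<open>The leading digit alone suffices: it exceeds q_k for k the block index, and its place
  value is at least the product of the earlier q_j.\<close>

lemma seq_term_lower:
  assumes "p \<in> I"
  shows "2 ^ ((blk p)\<^sup>2) \<le> a p"
proof -
  have k: "1 \<le> blk p" using blk_ge_1[OF assms] .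
  have "2 ^ ((blk p)\<^sup>2) \<le> (\<Prod>j\<in>{0<..blk p}. q j)" using prod_q_lower[of 0 "blk p"] by simp
  also have "{0<..blk p} = insert (blk p) {1..<blk p}" using k by auto
  also have "(\<Prod>j\<in>\<dots>. q j) = q (blk p) * (\<Prod>j\<in>{1..<blk p}. q j)" by simp
  also have "\<dots> \<le> D p (blk p) * (\<Prod>j\<in>{1..<blk p}. 4 * q j)"
    using digit_bounds(1)[OF assms k] by (intro mult_mono prod_mono) auto
  also have "\<dots> \<le> a p"
    unfolding seq_term_def using k
    by (intro member_le_sum[of "blk p" _ "\<lambda>j. D p j * (\<Prod>i\<in>{1..<j}. 4 * q i)"]) auto
  finally show ?thesis .
qed

text \<open>Since 4 q_j \<le> 2^(2 j + 3), the place value just above position k is at most 2 to the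
  sum of these exponents, k^2 + 4 k.\<close>

lemma seq_term_upper:
  assumes "p \<in> I" "blk p \<le> k"
  shows "a p < 2 ^ (k\<^sup>2 + 4 * k)"
proof -
  have "a p < (\<Prod>j\<in>{1..k}. 4 * q j)"
    unfolding seq_term_eq[OF assms(2)] using digit_less[OF assms(1)]
    by (intro mixed_radix_less) (fastforce intro: less_le_trans)
  also have "\<dots> \<le> 2 ^ (k\<^sup>2 + 4 * k)"
  proof (induction k)
    case (Suc k)
    have "4 * q (Suc k) \<le> 2 ^ (2 * Suc k + 3)" using q_upper[of "Suc k"] by (simp add: power_add)
    with Suc have "(\<Prod>j\<in>{1..k}. 4 * q j) * (4 * q (Suc k)) \<le> 2 ^ (k\<^sup>2 + 4 * k) * 2 ^ (2 * Suc k + 3)"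
      by (rule mult_mono) simp_all
    hence "(\<Prod>j\<in>{1..Suc k}. 4 * q j) \<le> 2 ^ (k\<^sup>2 + 4 * k) * 2 ^ (2 * Suc k + 3)"
      by simp
    also have "\<dots> = 2 ^ ((Suc k)\<^sup>2 + 4 * Suc k)"
      by (simp add: power_add [symmetric] power2_eq_square algebra_simps)
    finally show ?case .
  qed simp
  finally show ?thesis .
qed

lemma index_prime_le:
  assumes "p \<in> I" "real (a p) \<le> x"
  shows "real p \<le> x powr c"
proof -
  have "real p \<le> 2 powr (c * (real (blk p))\<^sup>2 - 3)"
    using assms(1) by (intro blk_upper index_primes_primeD)
  also have "\<dots> \<le> 2 powr (real ((blk p)\<^sup>2) * c)" by (simp add: mult.commute)
  also have "\<dots> = real (2 ^ ((blk p)\<^sup>2)) powr c"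
    using powr_realpow[of 2 "(blk p)\<^sup>2"] by (simp add: powr_powr [symmetric])
  also have "\<dots> \<le> x powr c"
  proof (rule powr_mono2)
    show "real (2 ^ ((blk p)\<^sup>2)) \<le> x"
      using seq_term_lower[OF assms(1)] assms(2) of_nat_mono by (metis order_trans)
  qed (use c in auto)
  finally show ?thesis .
qed

lemma
  shows finite_seq_term_le: "finite {p \<in> I. real (a p) \<le> x}" (is ?A)
    and counting_fun_le: "real (counting_fun c q g x) \<le> x powr c" (is ?B)
proof -
  have sub: "{p \<in> I. real (a p) \<le> x} \<subseteq> {1..nat \<lfloor>x powr c\<rfloor>}"
    using index_prime_le prime_ge_1_nat index_primes_primeD by (auto simp: le_nat_iff le_floor_iff)
  thus ?A by (rule finite_subset) simp
  have "counting_fun c q g x \<le> nat \<lfloor>x powr c\<rfloor>"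
    unfolding counting_fun_def using card_mono[OF _ sub] by simp
  thus ?B by (simp add: le_nat_iff le_floor_iff)
qed

text \<open>Blocks increase with the primes, so a prime up to n lies in block k or earlier. Its term
  is then below 2^(k^2 + 4 k), unless it is one of the finitely many primes without a full set of
  digits.\<close>

lemma counting_fun_ge:
  assumes "2 ^ (k\<^sup>2 + 4 * k) \<le> x" "real n \<le> 2 powr (c * (real k)\<^sup>2 - 3)"
  shows "card {p. prime p \<and> p \<le> n} \<le> counting_fun c q g x + card ({p. prime p} - I)"
proof -
  have "{p. prime p \<and> p \<le> n} \<subseteq> {p \<in> I. real (a p) \<le> x} \<union> ({p. prime p} - I)"
  proof
    fix p assume p: "p \<in> {p. prime p \<and> p \<le> n}"
    show "p \<in> {p \<in> I. real (a p) \<le> x} \<union> ({p. prime p} - I)"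
    proof (cases "p \<in> I")
      case True
      have "2 powr (c * (real (blk p) - 1)\<^sup>2 - 3) < real p" using p blk_lower by blast
      also have "\<dots> \<le> 2 powr (c * (real k)\<^sup>2 - 3)" using p assms(2) by simp
      finally have "(real (blk p) - 1)\<^sup>2 < (real k)\<^sup>2" using c by simp
      hence "real (blk p) - 1 < real k" by (rule power2_less_imp_less) simp
      hence "a p < 2 ^ (k\<^sup>2 + 4 * k)" by (intro seq_term_upper True) linarith
      hence "real (a p) < 2 ^ (k\<^sup>2 + 4 * k)" by (metis of_nat_less_numeral_power_cancel_iff)
      hence "real (a p) \<le> x" using assms(1) by (rule less_imp_le[OF less_le_trans])
      thus ?thesis using True by simp
    qed (use p in auto)
  qed
  hence "card {p. prime p \<and> p \<le> n} \<le> card ({p \<in> I. real (a p) \<le> x} \<union> ({p. prime p} - I))"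
    by (rule card_mono[rotated]) (use finite_seq_term_le finite_non_index_primes in simp)
  also have "\<dots> \<le> counting_fun c q g x + card ({p. prime p} - I)"
    unfolding counting_fun_def by (rule card_Un_le)
  finally show ?thesis .
qed

lemma counting_fun_lower:
  assumes "k \<ge> 1" "2 ^ (k\<^sup>2 + 4 * k) \<le> x"
  shows "(2 powr (c * (real k)\<^sup>2 - 3) - 2) / (real k)\<^sup>2 - real (card ({p. prime p} - I))
           \<le> real (counting_fun c q g x)"
proof -
  \<comment> \<open>The prime bound at n, the floor of \<open>Y\<close>, reads (n - 1) ln 2 \<le> N
    ln n, and ln n \<le> k^2 ln 2. The 2 subtracted from \<open>Y\<close> pays for the floor and for
    n - 1.\<close>
  define Y where "Y = 2 powr (c * (real k)\<^sup>2 - 3)"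
  define n where "n = nat \<lfloor>Y\<rfloor>"
  define N where "N = card {p. prime p \<and> p \<le> n}"
  have Y: "Y > 0" by (simp add: Y_def)
  hence n: "real n \<le> Y" "Y - 1 \<le> real n" unfolding n_def by linarith+
  have "Y - 2 \<le> real N * (real k)\<^sup>2"
  proof (cases "n \<ge> 1")
    case True
    have "real (n - 1) * ln 2 = ln (2 ^ (n - 1))" by (simp add: ln_realpow)
    also have "\<dots> \<le> ln (real n ^ N)"
      using card_primes_lower_bound[OF True] True unfolding N_def
      by (subst ln_le_cancel_iff) (simp_all flip: of_nat_power add: of_nat_le_iff)
    also have "\<dots> = real N * ln (real n)" using True by (simp add: ln_realpow)
    also have "\<dots> \<le> real N * ((real k)\<^sup>2 * ln 2)"
    proof (rule mult_left_mono)
      have "ln (real n) \<le> ln Y" using n True by simp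
      also have "\<dots> = (c * (real k)\<^sup>2 - 3) * ln 2" by (simp add: Y_def ln_powr)
      also have "\<dots> \<le> (real k)\<^sup>2 * ln 2"
        using mult_right_mono[of c 1 "(real k)\<^sup>2"] c by (intro mult_right_mono) auto
      finally show "ln (real n) \<le> (real k)\<^sup>2 * ln 2" .
    qed simp
    finally have "real (n - 1) \<le> real N * (real k)\<^sup>2" by simp
    thus ?thesis using n True by (simp add: of_nat_diff)
  next
    case False
    hence "Y - 2 \<le> 0" using n by simp
    also have "0 \<le> real N * (real k)\<^sup>2" by simp
    finally show ?thesis .
  qed
  hence "(Y - 2) / (real k)\<^sup>2 \<le> real N" using assms(1) by (simp add: field_simps)
  also have "real N \<le> real (counting_fun c q g x + card ({p. prime p} - I))"
    unfolding N_def using n(1) assms(2) by (intro of_nat_mono counting_fun_ge) (simp_all add: Y_def)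
  finally show ?thesis by (simp add: Y_def)
qed

lemma
  shows counting_fun_exponent: "((\<lambda>x. ln (real (counting_fun c q g x)) / ln x) \<longlongrightarrow> c) at_top"
    and counting_fun_pos: "\<forall>\<^sub>F x in at_top. counting_fun c q g x > 0"
proof -
  let ?A = "counting_fun c q g"
  define C where "C = real (card ({p. prime p} - I))"
  define F where "F t = (2 powr (c * t\<^sup>2 - 3) - 2) / t\<^sup>2 - C" for t :: real
  \<comment> \<open>The condition k^2 + 4 k \<le> log 2 x is (k + 2)^2 \<le> log 2 x + 4, so
    \<open>k x\<close> is the largest admissible k once x is large. Maximality gives log 2 x \<le>
    (k + 3)^2, which costs nothing in the limit.\<close>
  define s where "s x = sqrt (log 2 x + 4)" for x :: real
  define k where "k x = nat \<lfloor>s x\<rfloor> - 2" for x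
  have F_lim: "filterlim F at_top at_top" unfolding F_def using c by real_asymp
  have G_lim: "((\<lambda>t. ln (F t) / (ln 2 * (t + 3)\<^sup>2)) \<longlongrightarrow> c) at_top"
    unfolding F_def using c by real_asymp
  have k_lim: "filterlim (\<lambda>x. real (k x)) at_top at_top"
  proof (rule filterlim_at_top_mono)
    show "filterlim (\<lambda>x. s x - 3) at_top at_top" unfolding s_def by real_asymp
    show "\<forall>\<^sub>F x in at_top. s x - 3 \<le> real (k x)"
      \<comment> \<open>Truncated subtraction can only enlarge \<open>k x\<close>, so this holds for
        every x.\<close>
      unfolding k_def by (intro always_eventually allI) linarith
  qed
  have bounds: "\<forall>\<^sub>F x in at_top. 1 < x \<and> 1 \<le> F (real (k x)) \<and> F (real (k x)) \<le> real (?A x)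
                  \<and> ln x \<le> ln 2 * (real (k x) + 3)\<^sup>2"
  proof -
    have "\<forall>\<^sub>F x in at_top. 1 \<le> F (real (k x))"
      using filterlim_compose[OF F_lim k_lim] by (simp add: filterlim_at_top)
    moreover have "\<forall>\<^sub>F x in at_top. 1 \<le> real (k x)"
      using k_lim unfolding filterlim_at_top by blast
    ultimately show ?thesis using eventually_gt_at_top[of 1]
    proof eventually_elim
      case (elim x)
      have "0 \<le> log 2 x" using elim by simp
      hence s: "(s x)\<^sup>2 = log 2 x + 4" "s x \<ge> 0" by (simp_all add: s_def)
      have k: "1 \<le> k x" "real (k x) + 2 \<le> s x" "s x \<le> real (k x) + 3"
        using elim s(2) unfolding k_def by linarith+
      have "(real (k x) + 2)\<^sup>2 \<le> (s x)\<^sup>2" using k by (intro power_mono) auto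
      hence "real ((k x)\<^sup>2 + 4 * k x) \<le> log 2 x"
        unfolding s by (simp add: power2_eq_square algebra_simps)
      hence "2 powr real ((k x)\<^sup>2 + 4 * k x) \<le> x" using elim by (simp add: le_log_iff)
      hence "2 ^ ((k x)\<^sup>2 + 4 * k x) \<le> x" by (subst (asm) powr_realpow) simp_all
      hence "F (real (k x)) \<le> real (?A x)"
        unfolding F_def C_def using k by (intro counting_fun_lower)
      moreover have "(s x)\<^sup>2 \<le> (real (k x) + 3)\<^sup>2" using k s by (intro power_mono) auto
      hence "log 2 x \<le> (real (k x) + 3)\<^sup>2" unfolding s by simp
      hence "ln x \<le> ln 2 * (real (k x) + 3)\<^sup>2" by (simp add: log_def field_simps)
      ultimately show ?case using elim by simp
    qed
  qed
  show "\<forall>\<^sub>F x in at_top. ?A x > 0"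
    using bounds by eventually_elim (auto intro: Nat.gr0I)
  show "((\<lambda>x. ln (real (?A x)) / ln x) \<longlongrightarrow> c) at_top"
  proof (rule tendsto_sandwich)
    show "((\<lambda>x. ln (F (real (k x))) / (ln 2 * (real (k x) + 3)\<^sup>2)) \<longlongrightarrow> c) at_top"
      by (rule filterlim_compose[OF G_lim k_lim])
    show "\<forall>\<^sub>F x in at_top. ln (F (real (k x))) / (ln 2 * (real (k x) + 3)\<^sup>2)
            \<le> ln (real (?A x)) / ln x"
      using bounds by eventually_elim (intro frac_le, auto)
    show "\<forall>\<^sub>F x in at_top. ln (real (?A x)) / ln x \<le> c"
      using bounds
    proof eventually_elim
      case (elim x)
      hence "ln (real (?A x)) \<le> ln (x powr c)"
        using counting_fun_le[of x] by (subst ln_le_cancel_iff) auto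
      thus ?case using elim by (simp add: ln_powr field_simps)
    qed
  qed simp
qed

end

theorem theorem1:
  fixes c :: real and q g :: "nat \<Rightarrow> nat"
  assumes "c = (3 - sqrt 5) / 2"
    and "\<And>j. j \<ge> 1 \<Longrightarrow> prime (q j)"
    and "\<And>j. j \<ge> 1 \<Longrightarrow> 2 ^ (2 * j - 1) < q j \<and> q j \<le> 2 ^ (2 * j + 1)"
    and "\<And>j. j \<ge> 1 \<Longrightarrow> residue_primroot (q j) (g j)"
  shows "infinite (seq_term c q g ` index_primes c q g)
    \<and> inj_on (seq_term c q g) (index_primes c q g)
    \<and> sidon_set (seq_term c q g ` index_primes c q g)
    \<and> (\<exists>\<epsilon> :: real \<Rightarrow> real. \<epsilon> \<in> o(\<lambda>_. 1) \<and>
         (\<forall>\<^sub>F x in at_top.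
            real (counting_fun c q g x) = x powr ((3 - sqrt 5) / 2 + \<epsilon> x)))"
proof -
  have sqrt5: "2 < sqrt 5" "sqrt 5 < 3" by (auto intro: real_less_rsqrt real_less_lsqrt)
  interpret digit_base c q g
    using assms sqrt5 by unfold_locales auto
  \<comment> \<open>This c is the smaller root of c = (1 - c)^2, hence the largest exponent in (0,
    1/2) satisfying the inequality.\<close>
  have "(1 - c)\<^sup>2 = c"
    by (simp add: assms(1) power2_eq_square field_simps)
  hence golden: "c \<le> (1 - c)\<^sup>2" by simp
  have inj: "inj_on a I" using golden by (rule inj_on_seq_term)
  \<comment> \<open>The exact exponent of A(x) to base x, minus c. Recovering A(x) from its
    logarithm needs A(x) > 0 and x > 1, which hold eventually.\<close>
  let ?\<epsilon> = "\<lambda>x. ln (real (counting_fun c q g x)) / ln x - c"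
  have "(?\<epsilon> \<longlongrightarrow> c - c) at_top" by (intro tendsto_intros counting_fun_exponent)
  hence "?\<epsilon> \<in> o(\<lambda>_. 1)" by (intro smalloI_tendsto) simp_all
  moreover have "\<forall>\<^sub>F x in at_top. real (counting_fun c q g x) = x powr ((3 - sqrt 5) / 2 + ?\<epsilon> x)"
    using counting_fun_pos eventually_gt_at_top[of 1]
  proof eventually_elim
    case (elim x)
    have "x powr ((3 - sqrt 5) / 2 + ?\<epsilon> x) = x powr (ln (real (counting_fun c q g x)) / ln x)"
      by (simp add: assms(1))
    also have "\<dots> = real (counting_fun c q g x)" using elim by (simp add: powr_def)
    finally show ?case by simp
  qed
  ultimately show ?thesis
    using inj infinite_index_primes sidon_set_seq_term[OF golden] by (auto simp: finite_image_iff)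
qed

end
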